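(* Let $\mathcal H$ be an infinite-dimensional complex Hilbert space and $\mathcal Z$ an infinite countable set. Let $A:\mathcal H\to\mathcal H$ be an invertible, bounded, linear operator with absolutely collision-free eigenvalues that is diagonalizable by a known $S:\ell^2(\mathcal Z)\to\mathcal H$, i.e. $A=S\Lambda S^{-1}$. Let $\{\phi_i\}_{i=0}^\infty\subset\mathcal H$ allow parameter identification and phase retrieval with finitely supported $S^{-1}\phi_i$, and let $y:=S^*x$ be elementwise non-zero for the unknown $x\in\mathcal H$. Then the eigenvalues $\lambda_k$, $k\in\mathcal Z$, of $A$ and the signal $x$ are determined by the spatiotemporal samples $$\bigl\{|\langle x,A^\ell\phi_i\rangle| : i\in\mathbb{N}_0,\ \ell=0,\dots,2L_i^2-1\bigr\}\quad\text{with}\quad L_i:=\#[\operatorname{supp}(S^{-1}\phi_i)]$$ up to a global phase. That is, if $A'=S\Lambda'S^{-1}$ (with multiplication operator $\Lambda'$ with eigenvalues $\lambda'_k$) and $x'\in\mathcal H$ satisfy the same hypotheses and yield the same samples, then there are $\theta,\vartheta\in\mathbb{R}$ with $\lambda'_k=e^{i\theta}\lambda_k$ for all $k\in\mathcal Z$ and $x'=e^{i\vartheta}x$.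
   Context: An invertible, bounded, linear operator $A:\mathcal H\to\mathcal H$ is diagonalizable if $A=S\Lambda S^{-1}$, where $S:\ell^2(\mathcal Z)\to\mathcal H$ is an invertible, bounded, linear operator and $\Lambda:\ell^2(\mathcal Z)\to\ell^2(\mathcal Z)$, $\Lambda(y)=(\lambda_ky_k)_{k\in\mathcal Z}$, is a multiplication operator with bounded eigenvalues $\lambda_k\in\mathbb{C}\setminus\{0\}$. $S^*$ is the adjoint; $\operatorname{supp}$ is the set of indices of non-zero components. The family $(\lambda_k)_{k\in\mathcal Z}$ is absolutely collision-free if the products $\lambda_j\overline{\lambda_k}$ are pairwise distinct for distinct ordered pairs $(j,k)\in\mathcal Z^2$ and the products $|\lambda_j||\lambda_k|$ are pairwise distinct for distinct unordered pairs $\{j,k\}$ with $j\ne k$. With $\psi_i:=S^{-1}\phi_i$ (components $\psi_{i,k}$, $k\in\mathcal Z$), the set $\{\phi_i\}_{i=0}^\infty$ allows parameter identification and phase retrieval if the following three properties hold. (i) Index separation: $\bigcup_{i}\operatorname{supp}\psi_i=\mathcal Z$, and for every $k\in\mathcal Z$ there exist index sets $\mathcal F_k,\mathcal G_k\subset\mathbb{N}_0$ with $\{k\}=\bigcap_{i\in\mathcal F_k}\operatorname{supp}\psi_i\setminus\bigcup_{i\in\mathcal G_k}\operatorname{supp}\psi_i$. (ii) Phase propagation: $\#\bigl[\operatorname{supp}\psi_n\cap\bigcup_{i=0}^{n-1}\operatorname{supp}\psi_i\bigr]\ge2$ for all $n\ge1$. (iii) Winding direction determination: there are indices $i_1,i_2\in\mathbb{N}_0$,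 $k_1,k_2\in\mathcal Z$ such that $\psi_{i_1,k_1}\overline{\psi_{i_1,k_2}}$ and $\psi_{i_2,k_1}\overline{\psi_{i_2,k_2}}$ are non-zero and $\arg(\psi_{i_1,k_1}\overline{\psi_{i_1,k_2}})\not\equiv\arg(\psi_{i_2,k_1}\overline{\psi_{i_2,k_2}})\pmod\pi$. *)

theory Defs
  imports "HOL-Analysis.Analysis" "HOL-Library.Real_Mod"
begin

section \<open>Complex Hilbert spaces\<close>

text \<open>
  A complex inner product space is a complex vector space with a sesquilinear form, linear in
  the first argument, whose real part is the inner product of the underlying real space.
  Positivity and definiteness of \<open>cinner\<close>, and \<open>norm x = sqrt (cinner x x)\<close>, then come from
  \<^class>\<open>real_inner\<close>.
\<close>

class complex_inner = real_inner +
  fixes scaleC :: "complex \<Rightarrow> 'a \<Rightarrow> 'a" (infixr \<open>*\<^sub>C\<close> 75)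
    and cinner :: "'a \<Rightarrow> 'a \<Rightarrow> complex"
  assumes scaleC_add_right: "c *\<^sub>C (x + y) = c *\<^sub>C x + c *\<^sub>C y"
    and scaleC_add_left: "(c + d) *\<^sub>C x = c *\<^sub>C x + d *\<^sub>C x"
    and scaleC_scaleC: "c *\<^sub>C d *\<^sub>C x = (c * d) *\<^sub>C x"
    and scaleR_scaleC: "r *\<^sub>R x = complex_of_real r *\<^sub>C x"
    and cinner_commute: "cinner x y = cnj (cinner y x)"
    and cinner_add_left: "cinner (x + y) z = cinner x z + cinner y z"
    and cinner_scaleC_left: "cinner (c *\<^sub>C x) y = c * cinner x y"
    and inner_eq_Re_cinner: "inner x y = Re (cinner x y)"

class chilbert_space = complex_inner + complete_space

lemma vector_space_scaleC:
  "vector_space (scaleC :: complex \<Rightarrow> 'a \<Rightarrow> 'a::complex_inner)"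
proof
  show "1 *\<^sub>C x = x" for x :: 'a
    using scaleR_scaleC[of 1 x] by simp
qed (simp_all add: scaleC_add_right scaleC_add_left scaleC_scaleC)

definition infinite_cdim :: "'a::complex_inner itself \<Rightarrow> bool" where
  "infinite_cdim _ \<longleftrightarrow> \<not> (\<exists>B::'a set. finite B \<and> module.span scaleC B = UNIV)"

definition bounded_clinear :: "('a::complex_inner \<Rightarrow> 'b::complex_inner) \<Rightarrow> bool" where
  "bounded_clinear f \<longleftrightarrow> bounded_linear f \<and> (\<forall>c x. f (c *\<^sub>C x) = c *\<^sub>C f x)"

definition invertible_op :: "('a::complex_inner \<Rightarrow> 'b::complex_inner) \<Rightarrow> bool" where
  "invertible_op f \<longleftrightarrow>
     bounded_clinear f \<and> (\<exists>g. bounded_clinear g \<and> g \<circ> f = id \<and> f \<circ> g = id)"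

text \<open>
  The Hilbert space adjoint; existence for bounded operators on \<open>\<ell>\<^sup>2\<close>, the only case needed
  here, is \<open>cinner_cadjoint\<close> below.
\<close>

definition cadjoint :: "('a::complex_inner \<Rightarrow> 'b::complex_inner) \<Rightarrow> 'b \<Rightarrow> 'a" where
  "cadjoint f = (SOME g. \<forall>x y. cinner (f x) y = cinner x (g y))"

section \<open>The space \<open>\<ell>\<^sup>2(Z)\<close>\<close>

text \<open>The index set is the universe of the type \<open>'z\<close>.\<close>

typedef 'z ell2 = "{y :: 'z \<Rightarrow> complex. (\<lambda>k. (cmod (y k))\<^sup>2) summable_on UNIV}"
  morphisms coord Abs_ell2
  by (rule exI[of _ "\<lambda>_. 0"]) simp

setup_lifting type_definition_ell2

lemma ell2_prod_abs_summable:
  fixes f g :: "'z \<Rightarrow> complex"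
  assumes "(\<lambda>k. (cmod (f k))\<^sup>2) summable_on UNIV" "(\<lambda>k. (cmod (g k))\<^sup>2) summable_on UNIV"
  shows "(\<lambda>k. norm (f k * cnj (g k))) summable_on UNIV"
proof (rule summable_on_comparison_test)
  show "(\<lambda>k. (cmod (f k))\<^sup>2 + (cmod (g k))\<^sup>2) summable_on UNIV"
    using assms by (rule summable_on_add)
  show "cmod (f k * cnj (g k)) \<le> (cmod (f k))\<^sup>2 + (cmod (g k))\<^sup>2" for k
  proof -
    have "2 * cmod (f k) * cmod (g k) \<le> (cmod (f k))\<^sup>2 + (cmod (g k))\<^sup>2"
      by (rule sum_squares_bound)
    moreover have "0 \<le> cmod (f k) * cmod (g k)" by simp
    ultimately show ?thesis by (simp only: norm_mult complex_mod_cnj)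
  qed
qed simp

lemma ell2_add_summable:
  fixes f g :: "'z \<Rightarrow> complex"
  assumes "(\<lambda>k. (cmod (f k))\<^sup>2) summable_on UNIV" "(\<lambda>k. (cmod (g k))\<^sup>2) summable_on UNIV"
  shows "(\<lambda>k. (cmod (f k + g k))\<^sup>2) summable_on UNIV"
proof (rule summable_on_comparison_test)
  show "(\<lambda>k. 2 * (cmod (f k))\<^sup>2 + 2 * (cmod (g k))\<^sup>2) summable_on UNIV"
    using assms by (intro summable_on_add summable_on_cmult_right)
  show "(cmod (f k + g k))\<^sup>2 \<le> 2 * (cmod (f k))\<^sup>2 + 2 * (cmod (g k))\<^sup>2" for k
  proof -
    have "(cmod (f k + g k))\<^sup>2 \<le> (cmod (f k) + cmod (g k))\<^sup>2"
      by (intro power_mono norm_triangle_ineq) simp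
    also have "\<dots> \<le> 2 * (cmod (f k))\<^sup>2 + 2 * (cmod (g k))\<^sup>2"
      using sum_squares_bound[of "cmod (f k)" "cmod (g k)"] by (simp add: power2_sum)
    finally show ?thesis .
  qed
qed simp

lemma ell2_mult_summable:
  fixes f g :: "'z \<Rightarrow> complex"
  assumes "(\<lambda>k. (cmod (f k))\<^sup>2) summable_on UNIV" "bounded (range g)"
  shows "(\<lambda>k. (cmod (g k * f k))\<^sup>2) summable_on UNIV"
proof -
  obtain B where B: "\<And>k. cmod (g k) \<le> B"
    using assms(2) by (auto simp: bounded_iff)
  show ?thesis
  proof (rule summable_on_comparison_test)
    show "(\<lambda>k. B\<^sup>2 * (cmod (f k))\<^sup>2) summable_on UNIV"
      using assms(1) by (rule summable_on_cmult_right)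
    show "(cmod (g k * f k))\<^sup>2 \<le> B\<^sup>2 * (cmod (f k))\<^sup>2" for k
      using B by (auto simp: norm_mult power_mult_distrib intro!: mult_right_mono power_mono)
  qed simp
qed

lemma infsum_mult_cnj_self:
  fixes f :: "'z \<Rightarrow> complex"
  assumes "(\<lambda>k. (cmod (f k))\<^sup>2) summable_on UNIV"
  shows "(\<Sum>\<^sub>\<infinity>k. f k * cnj (f k)) = complex_of_real (\<Sum>\<^sub>\<infinity>k. (cmod (f k))\<^sup>2)"
  unfolding complex_norm_square[symmetric]
  by (rule infsumI) (rule has_sum_of_real_iff[THEN iffD2, OF has_sum_infsum[OF assms]])

instantiation ell2 :: (type) complex_inner
begin

lift_definition zero_ell2 :: "'a ell2" is "\<lambda>_. 0" by simp
lift_definition plus_ell2 :: "'a ell2 \<Rightarrow> 'a ell2 \<Rightarrow> 'a ell2" is "\<lambda>f g k. f k + g k"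
  by (simp add: ell2_add_summable)
lift_definition uminus_ell2 :: "'a ell2 \<Rightarrow> 'a ell2" is "\<lambda>f k. - f k" by simp
lift_definition scaleC_ell2 :: "complex \<Rightarrow> 'a ell2 \<Rightarrow> 'a ell2" is "\<lambda>c f k. c * f k"
  by (rule ell2_mult_summable) auto
lift_definition cinner_ell2 :: "'a ell2 \<Rightarrow> 'a ell2 \<Rightarrow> complex" is
  "\<lambda>f g. \<Sum>\<^sub>\<infinity>k. f k * cnj (g k)" .

definition minus_ell2 :: "'a ell2 \<Rightarrow> 'a ell2 \<Rightarrow> 'a ell2" where "minus_ell2 f g = f + - g"
definition scaleR_ell2 :: "real \<Rightarrow> 'a ell2 \<Rightarrow> 'a ell2" where
  "scaleR_ell2 r f = complex_of_real r *\<^sub>C f"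
definition inner_ell2 :: "'a ell2 \<Rightarrow> 'a ell2 \<Rightarrow> real" where "inner_ell2 f g = Re (cinner f g)"
definition norm_ell2 :: "'a ell2 \<Rightarrow> real" where "norm_ell2 f = sqrt (inner f f)"
definition dist_ell2 :: "'a ell2 \<Rightarrow> 'a ell2 \<Rightarrow> real" where "dist_ell2 f g = norm (f - g)"
definition sgn_ell2 :: "'a ell2 \<Rightarrow> 'a ell2" where "sgn_ell2 f = inverse (norm f) *\<^sub>R f"
definition uniformity_ell2 :: "('a ell2 \<times> 'a ell2) filter" where
  "uniformity_ell2 = (INF e\<in>{0<..}. principal {(x, y). dist x y < e})"
definition open_ell2 :: "'a ell2 set \<Rightarrow> bool" where
  "open_ell2 U \<longleftrightarrow> (\<forall>x\<in>U. \<forall>\<^sub>F (x', y) in uniformity. x' = x \<longrightarrow> y \<in> U)"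

instance
proof
  fix f g h :: "'a ell2" and c d :: complex and r s :: real
  show assoc: "f + g + h = f + (g + h)" by transfer (simp add: add.assoc)
  show "f + g = g + f" by transfer (simp add: add.commute)
  show "0 + f = f" by transfer simp
  show "- f + f = 0" by transfer simp
  show "f - g = f + - g" by (rule minus_ell2_def)
  show addr: "c *\<^sub>C (f + g) = c *\<^sub>C f + c *\<^sub>C g" for c :: complex and f g :: "'a ell2"
    by transfer (simp add: algebra_simps)
  show addl: "(c + d) *\<^sub>C f = c *\<^sub>C f + d *\<^sub>C f" for c d :: complex and f :: "'a ell2"
    by transfer (simp add: algebra_simps)
  show scc: "c *\<^sub>C d *\<^sub>C f = (c * d) *\<^sub>C f" for c d :: complex and f :: "'a ell2"
    by transfer (simp add: algebra_simps)
  show "r *\<^sub>R f = complex_of_real r *\<^sub>C f" by (rule scaleR_ell2_def)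
  show "r *\<^sub>R (f + g) = r *\<^sub>R f + r *\<^sub>R g" "(r + s) *\<^sub>R f = r *\<^sub>R f + s *\<^sub>R f"
    "r *\<^sub>R s *\<^sub>R f = (r * s) *\<^sub>R f"
    by (simp_all add: scaleR_ell2_def addr addl scc)
  show "1 *\<^sub>R f = f" unfolding scaleR_ell2_def by transfer simp
  show "dist f g = norm (f - g)" by (rule dist_ell2_def)
  show "sgn f = inverse (norm f) *\<^sub>R f" by (rule sgn_ell2_def)
  show "uniformity = (INF e\<in>{0<..}. principal {(x, y :: 'a ell2). dist x y < e})"
    by (rule uniformity_ell2_def)
  show "open U \<longleftrightarrow> (\<forall>x\<in>U. \<forall>\<^sub>F (x', y) in uniformity. x' = x \<longrightarrow> y \<in> U)" for U :: "'a ell2 set"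
    by (rule open_ell2_def)
  show comm: "cinner f g = cnj (cinner g f)" for f g :: "'a ell2"
    by transfer (simp flip: infsum_cnj add: mult.commute)
  show cadd: "cinner (f + g) h = cinner f h + cinner g h"
  proof transfer
    fix f g h :: "'a \<Rightarrow> complex"
    assume "(\<lambda>k. (cmod (f k))\<^sup>2) summable_on UNIV" "(\<lambda>k. (cmod (g k))\<^sup>2) summable_on UNIV"
      "(\<lambda>k. (cmod (h k))\<^sup>2) summable_on UNIV"
    then show "(\<Sum>\<^sub>\<infinity>k. (f k + g k) * cnj (h k)) =
        (\<Sum>\<^sub>\<infinity>k. f k * cnj (h k)) + (\<Sum>\<^sub>\<infinity>k. g k * cnj (h k))"
      by (simp add: distrib_right infsum_add ell2_prod_abs_summable abs_summable_summable)
  qed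
  show cscale: "cinner (c *\<^sub>C f) g = c * cinner f g" for c :: complex
    by transfer (simp add: mult.assoc infsum_cmult_right')
  show "inner f g = Re (cinner f g)" by (rule inner_ell2_def)
  show "inner f g = inner g f" unfolding inner_ell2_def by (subst comm) simp
  show "inner (f + g) h = inner f h + inner g h" by (simp add: inner_ell2_def cadd)
  show "inner (r *\<^sub>R f) g = r * inner f g"
    by (simp add: inner_ell2_def scaleR_ell2_def cscale)
  have self: "cinner f f = complex_of_real (\<Sum>\<^sub>\<infinity>k. (cmod (coord f k))\<^sup>2)"
    using coord[of f] by (simp add: cinner_ell2.rep_eq infsum_mult_cnj_self)
  show "0 \<le> inner f f" by (simp add: inner_ell2_def self infsum_nonneg)
  show "inner f f = 0 \<longleftrightarrow> f = 0"
  proof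
    assume "inner f f = 0"
    then have *: "(\<Sum>\<^sub>\<infinity>k. (cmod (coord f k))\<^sup>2) \<le> 0" by (simp add: inner_ell2_def self)
    have "(cmod (coord f k))\<^sup>2 = 0" for k
      using nonneg_infsum_le_0D[OF *, of k] coord[of f] by auto
    then show "f = 0"
      by (auto simp: coord_inject[symmetric] zero_ell2.rep_eq)
  next
    assume "f = 0"
    then show "inner f f = 0" unfolding inner_ell2_def self by (simp add: zero_ell2.rep_eq)
  qed
  show "norm f = sqrt (inner f f)" by (rule norm_ell2_def)
qed

end

definition supp :: "'z ell2 \<Rightarrow> 'z set" where
  "supp y = {k. coord y k \<noteq> 0}"

text \<open>The multiplication operator; only meaningful for a bounded family \<open>lam\<close>.\<close>

definition multop :: "('z \<Rightarrow> complex) \<Rightarrow> 'z ell2 \<Rightarrow> 'z ell2" where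
  "multop lam y = Abs_ell2 (\<lambda>k. lam k * coord y k)"

lemma coord_multop:
  "bounded (range lam) \<Longrightarrow> coord (multop lam y) k = lam k * coord y k"
  using coord[of y] ell2_mult_summable[of "coord y" lam]
  by (simp add: multop_def Abs_ell2_inverse)

subsection \<open>Existence and uniqueness of the adjoint\<close>

lemma bounded_linear_cinner_left: "bounded_linear (\<lambda>u. cinner u x)"
proof -
  have *: "cinner u x = complex_of_real (inner u x) + \<i> * complex_of_real (inner u (\<i> *\<^sub>C x))" for u
  proof -
    have "cinner u (\<i> *\<^sub>C x) = - \<i> * cinner u x"
      by (subst (1 2) cinner_commute) (simp add: cinner_scaleC_left)
    then show ?thesis
      by (simp add: inner_eq_Re_cinner complex_eq_iff)
  qed
  show ?thesis
    unfolding * by (intro bounded_linear_add bounded_linear_const_mult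
        bounded_linear_compose[OF bounded_linear_of_real] bounded_linear_inner_left)
qed

lift_definition ell2_unit :: "'z \<Rightarrow> 'z ell2" is "\<lambda>j k. if k = j then 1 else 0"
proof -
  fix j :: 'z
  have "(\<lambda>k. (cmod (if k = j then 1 else 0))\<^sup>2) summable_on {j}" by simp
  then show "(\<lambda>k. (cmod (if k = j then 1 else 0))\<^sup>2) summable_on UNIV"
    by (rule summable_on_cong_neutral[THEN iffD1, rotated -1]) auto
qed

lemma coord_sum: "coord (sum g F) k = (\<Sum>j\<in>F. coord (g j) k)"
  by (induction F rule: infinite_finite_induct) (auto simp: zero_ell2.rep_eq plus_ell2.rep_eq)

lemma coord_trunc:
  "finite F \<Longrightarrow> coord (\<Sum>j\<in>F. a j *\<^sub>C ell2_unit j) k = (if k \<in> F then a k else 0)"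
  by (simp add: coord_sum scaleC_ell2.rep_eq ell2_unit.rep_eq if_distrib cong: if_cong)

lemma coord_minus: "coord (f - g) k = coord f k - coord g k"
  unfolding minus_ell2_def plus_ell2.rep_eq uminus_ell2.rep_eq by simp

lemma norm_ell2_sq: "(norm (f :: 'z ell2))\<^sup>2 = (\<Sum>\<^sub>\<infinity>k. (cmod (coord f k))\<^sup>2)"
proof -
  have "cinner f f = complex_of_real (\<Sum>\<^sub>\<infinity>k. (cmod (coord f k))\<^sup>2)"
    using coord[of f] by (simp add: cinner_ell2.rep_eq infsum_mult_cnj_self)
  then show ?thesis by (simp add: power2_norm_eq_inner inner_ell2_def)
qed

lemma ell2_has_sum: "((\<lambda>k. coord f k *\<^sub>C ell2_unit k) has_sum f) UNIV"
proof -
  let ?t = "\<lambda>F. \<Sum>k\<in>F. coord f k *\<^sub>C ell2_unit k"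
  let ?q = "\<lambda>k. (cmod (coord f k))\<^sup>2"
  have sm: "?q summable_on UNIV" using coord[of f] by simp
  have eq: "(norm (f - ?t F))\<^sup>2 = infsum ?q UNIV - sum ?q F" if "finite F" for F
  proof -
    have "(norm (f - ?t F))\<^sup>2 = (\<Sum>\<^sub>\<infinity>k. if k \<in> F then 0 else ?q k)"
      unfolding norm_ell2_sq using that
      by (intro infsum_cong)
        (simp add: coord_minus coord_trunc)
    also have "\<dots> = infsum ?q (UNIV - F)"
      by (intro infsum_cong_neutral) auto
    also have "\<dots> = infsum ?q UNIV - infsum ?q F"
      using sm that by (intro infsum_Diff) auto
    finally show ?thesis using that by simp
  qed
  have "(sum ?q \<longlongrightarrow> infsum ?q UNIV) (finite_subsets_at_top UNIV)"
    using has_sum_infsum[OF sm] by (simp add: has_sum_def)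
  then have "((\<lambda>F. sqrt (infsum ?q UNIV - sum ?q F)) \<longlongrightarrow> sqrt (infsum ?q UNIV - infsum ?q UNIV))
      (finite_subsets_at_top UNIV)"
    by (intro tendsto_intros)
  moreover have "sqrt (infsum ?q UNIV - sum ?q F) = dist (?t F) f" if "finite F" for F
    unfolding eq[OF that, symmetric] dist_norm by (subst norm_minus_commute) simp
  then have "\<forall>\<^sub>F F in finite_subsets_at_top UNIV.
      sqrt (infsum ?q UNIV - sum ?q F) = dist (?t F) f"
    by (intro eventually_finite_subsets_at_top_weakI)
  ultimately have "((\<lambda>F. dist (?t F) f) \<longlongrightarrow> sqrt (infsum ?q UNIV - infsum ?q UNIV))
      (finite_subsets_at_top UNIV)"
    by (rule Lim_transform_eventually)
  then have "((\<lambda>F. dist (?t F) f) \<longlongrightarrow> 0) (finite_subsets_at_top UNIV)"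
    by simp
  then show ?thesis
    unfolding has_sum_def by (rule tendsto_dist_iff[THEN iffD2])
qed

lemma cinner_cadjoint:
  fixes f :: "'z ell2 \<Rightarrow> 'b::complex_inner"
  assumes "bounded_clinear f"
  shows "cinner (f c) x = cinner c (cadjoint f x)"
proof -
  have bl: "bounded_linear f" and scale: "\<And>c x. f (c *\<^sub>C x) = c *\<^sub>C f x"
    using assms by (auto simp: bounded_clinear_def)
  interpret f: bounded_linear f by (rule bl)
  obtain K where K: "\<And>v. norm (f v) \<le> norm v * K" using f.nonneg_bounded by auto
  have "\<exists>y. \<forall>c. cinner (f c) x = cinner c y" for x
  proof -
    define h where "h = (\<lambda>v. cinner (f v) x)"
    have blh: "bounded_linear h"
      unfolding h_def by (rule bounded_linear_compose[OF bounded_linear_cinner_left bl])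
    have hscale: "h (c *\<^sub>C v) = c * h v" for c v
      by (simp add: h_def scale cinner_scaleC_left)
    define y where "y = (\<lambda>k. cnj (h (ell2_unit k)))"
    have bound: "(\<Sum>k\<in>F. (cmod (y k))\<^sup>2) \<le> (K * norm x)\<^sup>2" if F: "finite F" for F
    proof -
      define v where "v = (\<Sum>k\<in>F. y k *\<^sub>C ell2_unit k)"
      define q where "q = (\<Sum>k\<in>F. (cmod (y k))\<^sup>2)"
      have q0: "0 \<le> q" by (simp add: q_def sum_nonneg)
      have "h v = (\<Sum>k\<in>F. y k * h (ell2_unit k))"
        by (simp add: v_def linear_sum[OF bounded_linear.linear[OF blh]] hscale)
      also have "\<dots> = complex_of_real q"
        by (simp add: q_def complex_norm_square y_def mult.commute del: of_real_power)
      finally have "q = inner (f v) x" by (simp add: h_def inner_eq_Re_cinner)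
      also have "\<dots> \<le> norm (f v) * norm x" by (rule norm_cauchy_schwarz)
      also have "\<dots> \<le> norm v * K * norm x" by (intro mult_right_mono K) simp
      finally have le: "q \<le> norm v * (K * norm x)" by (simp add: mult.assoc)
      have "(norm v)\<^sup>2 = (\<Sum>\<^sub>\<infinity>k. if k \<in> F then (cmod (y k))\<^sup>2 else 0)"
        unfolding norm_ell2_sq v_def using F by (intro infsum_cong) (simp add: coord_trunc)
      also have "\<dots> = infsum (\<lambda>k. (cmod (y k))\<^sup>2) F" by (intro infsum_cong_neutral) auto
      finally have nv: "(norm v)\<^sup>2 = q" using F by (simp add: q_def)
      show ?thesis
      proof (cases "norm v = 0")
        case True
        then show ?thesis using nv by (simp flip: q_def)
      next
        case False
        then have "norm v \<le> K * norm x" using le nv[symmetric] by (simp add: power2_eq_square)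
        then show ?thesis unfolding q_def[symmetric] nv[symmetric] by (intro power_mono) simp_all
      qed
    qed
    have "(\<lambda>k. (cmod (y k))\<^sup>2) summable_on UNIV"
      by (intro nonneg_bdd_above_summable_on bdd_aboveI2[where M = "(K * norm x)\<^sup>2"])
        (auto intro: bound)
    then have cy: "coord (Abs_ell2 y) = y" by (simp add: Abs_ell2_inverse)
    have "cinner (f c) x = cinner c (Abs_ell2 y)" for c
    proof -
      have "((\<lambda>k. h (coord c k *\<^sub>C ell2_unit k)) has_sum h c) UNIV"
        by (rule has_sum_bounded_linear[OF blh ell2_has_sum])
      then have "(\<Sum>\<^sub>\<infinity>k. coord c k * cnj (y k)) = h c"
        by (simp add: hscale y_def infsumI)
      then show ?thesis
        by (simp add: cinner_ell2.rep_eq cy h_def)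
    qed
    then show ?thesis by blast
  qed
  then obtain g where "\<forall>c x. cinner (f c) x = cinner c (g x)" by metis
  then have "\<forall>c x. cinner (f c) x = cinner c (cadjoint f x)"
    unfolding cadjoint_def by (rule someI[of "\<lambda>g. \<forall>x y. cinner (f x) y = cinner x (g y)"])
  then show ?thesis by blast
qed

lemma cadjoint_unique:
  assumes "\<And>x y. cinner (f x) y = cinner x (g y)"
  shows "cadjoint f = g"
proof
  fix y
  have "\<forall>x y. cinner (f x) y = cinner x (cadjoint f y)"
    unfolding cadjoint_def by (rule someI[of _ g]) (simp add: assms)
  then have "inner x (cadjoint f y) = inner x (g y)" for x
    by (simp add: inner_eq_Re_cinner flip: assms)
  then show "cadjoint f y = g y"
    by (metis vector_eq_ldot)
qed

section \<open>Diagonalizability, collision-freeness and phase retrieval\<close>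

definition diagonalizes ::
  "('z ell2 \<Rightarrow> 'h::complex_inner) \<Rightarrow> ('z \<Rightarrow> complex) \<Rightarrow> ('h \<Rightarrow> 'h) \<Rightarrow> bool" where
  "diagonalizes S lam A \<longleftrightarrow>
     invertible_op S \<and> bounded (range lam) \<and> (\<forall>k. lam k \<noteq> 0) \<and> A = S \<circ> multop lam \<circ> inv S"

definition absolutely_collision_free :: "('z \<Rightarrow> complex) \<Rightarrow> bool" where
  "absolutely_collision_free lam \<longleftrightarrow>
     (\<forall>j k j' k'. (j, k) \<noteq> (j', k') \<longrightarrow> lam j * cnj (lam k) \<noteq> lam j' * cnj (lam k')) \<and>
     (\<forall>j k j' k'. j \<noteq> k \<longrightarrow> j' \<noteq> k' \<longrightarrow> {j, k} \<noteq> {j', k'} \<longrightarrow>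
        cmod (lam j) * cmod (lam k) \<noteq> cmod (lam j') * cmod (lam k'))"

definition index_separation :: "(nat \<Rightarrow> 'z ell2) \<Rightarrow> bool" where
  "index_separation \<psi> \<longleftrightarrow>
     (\<Union>i. supp (\<psi> i)) = UNIV \<and>
     (\<forall>k. \<exists>F G. {k} = (\<Inter>i\<in>F. supp (\<psi> i)) - (\<Union>i\<in>G. supp (\<psi> i)))"

text \<open>The supports may be infinite here, and \<open>card\<close> of an infinite set is 0.\<close>

definition phase_propagation :: "(nat \<Rightarrow> 'z ell2) \<Rightarrow> bool" where
  "phase_propagation \<psi> \<longleftrightarrow>
     (\<forall>n\<ge>1. let X = supp (\<psi> n) \<inter> (\<Union>i<n. supp (\<psi> i)) in infinite X \<or> card X \<ge> 2)"

definition winding_direction :: "(nat \<Rightarrow> 'z ell2) \<Rightarrow> bool" where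
  "winding_direction \<psi> \<longleftrightarrow>
     (\<exists>i\<^sub>1 i\<^sub>2 k\<^sub>1 k\<^sub>2.
        let p\<^sub>1 = coord (\<psi> i\<^sub>1) k\<^sub>1 * cnj (coord (\<psi> i\<^sub>1) k\<^sub>2);
            p\<^sub>2 = coord (\<psi> i\<^sub>2) k\<^sub>1 * cnj (coord (\<psi> i\<^sub>2) k\<^sub>2)
        in p\<^sub>1 \<noteq> 0 \<and> p\<^sub>2 \<noteq> 0 \<and> \<not> [Arg p\<^sub>1 = Arg p\<^sub>2] (rmod pi))"

definition allows_identification_and_retrieval ::
  "('z ell2 \<Rightarrow> 'h::complex_inner) \<Rightarrow> (nat \<Rightarrow> 'h) \<Rightarrow> bool" where
  "allows_identification_and_retrieval S \<phi> \<longleftrightarrow>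
     (let \<psi> = (\<lambda>i. inv S (\<phi> i))
      in index_separation \<psi> \<and> phase_propagation \<psi> \<and> winding_direction \<psi>)"

end

theory Submission
  imports Defs
begin

text \<open>
  The squared samples from \<open>\<phi> i\<close> form an exponential sum with at most \<open>(L i)\<^sup>2\<close> distinct nodes
  \<open>lam j * cnj (lam k)\<close>, so two such sums agreeing for \<open>2 * (L i)\<^sup>2\<close> exponents have the same
  nodes and coefficients. The real nodes give the moduli up to a permutation of the support, and
  index separation makes this permutation trivial. The remaining nodes give, on each support,
  the phases up to one common rotation and possibly a reflection. Since \<open>lam a * cnj (lam b)\<close> is
  not real for \<open>a \<noteq> b\<close>, two common indices force overlapping supports to agree on whether they are
  reflected, and the winding condition rules out the reflection.
\<close>

section \<open>Exponential sums determine their nodes and weights\<close>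

text \<open>The polynomial with roots exactly at the other nodes has degree
  \<open>card N - 1\<close>, so it only combines exponents below \<open>m\<close>; evaluating it
  isolates the term at \<open>u\<close>.\<close>

lemma vandermonde_zero:
  fixes w :: "complex \<Rightarrow> complex"
  assumes fin: "finite N" and le: "card N \<le> m"
    and zero: "\<And>l. l < m \<Longrightarrow> (\<Sum>z\<in>N. w z * z ^ l) = 0"
    and u: "u \<in> N"
  shows "w u = 0"
proof -
  define p where "p = (\<Prod>z\<in>N - {u}. [:- z, 1:])"
  have "degree p = card (N - {u})"
    by (simp add: p_def degree_prod_eq_sum_degree)
  moreover have "card (N - {u}) < card N"
    using fin u by (rule card_Diff1_less)
  ultimately have deg: "degree p < m"
    using le by simp
  have "(\<Sum>z\<in>N. w z * poly p z) = (\<Sum>i\<le>degree p. coeff p i * (\<Sum>z\<in>N. w z * z ^ i))"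
    unfolding poly_altdef sum_distrib_left by (subst sum.swap) (simp add: mult_ac)
  also have "\<dots> = 0"
    using zero deg by simp
  finally have "(\<Sum>z\<in>N. w z * poly p z) = 0" .
  moreover have "(\<Sum>z\<in>N. w z * poly p z) = w u * poly p u"
  proof -
    have "poly p z = 0" if "z \<in> N - {u}" for z
      using that fin by (force simp: p_def poly_prod)
    then show ?thesis
      by (simp add: sum.remove[OF fin u])
  qed
  moreover have "poly p u \<noteq> 0"
    using fin by (auto simp: p_def poly_prod)
  ultimately show ?thesis by simp
qed

text \<open>Both sums are grouped by node value over the union of the node sets, which has at most
  \<open>card I + card J\<close> elements, so the grouped weights agree. By injectivity each group
  has at most one index, and a non-zero weight forces the group on the other side to be
  inhabited.\<close>

lemma exponential_sum_match:
  fixes e :: "'p \<Rightarrow> complex" and e' :: "'q \<Rightarrow> complex"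
  assumes fin: "finite I" "finite J" and inj: "inj_on e I" "inj_on e' J"
    and eq: "\<And>l. l < card I + card J \<Longrightarrow> (\<Sum>p\<in>I. w p * e p ^ l) = (\<Sum>q\<in>J. w' q * e' q ^ l)"
    and q: "q \<in> J" "w' q \<noteq> 0"
  obtains p where "p \<in> I" "e p = e' q" "w p = w' q"
proof -
  define N where "N = e ` I \<union> e' ` J"
  define f where "f z = (\<Sum>p\<in>{p\<in>I. e p = z}. w p)" for z
  define g where "g z = (\<Sum>q\<in>{q\<in>J. e' q = z}. w' q)" for z
  have finN: "finite N"
    using fin by (simp add: N_def)
  have cardN: "card N \<le> card I + card J"
    unfolding N_def using card_Un_le card_image_le fin
    by (metis (no_types, lifting) add_mono_thms_linordered_semiring(1) order_trans)
  have f: "(\<Sum>z\<in>N. f z * z ^ l) = (\<Sum>p\<in>I. w p * e p ^ l)" for l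
  proof -
    have "(\<Sum>p\<in>I. w p * e p ^ l) = (\<Sum>z\<in>N. \<Sum>p\<in>{p\<in>I. e p = z}. w p * e p ^ l)"
      using fin finN by (subst sum.group) (auto simp: N_def)
    then show ?thesis
      by (simp add: f_def sum_distrib_right)
  qed
  have g: "(\<Sum>z\<in>N. g z * z ^ l) = (\<Sum>q\<in>J. w' q * e' q ^ l)" for l
  proof -
    have "(\<Sum>q\<in>J. w' q * e' q ^ l) = (\<Sum>z\<in>N. \<Sum>q\<in>{q\<in>J. e' q = z}. w' q * e' q ^ l)"
      using fin finN by (subst sum.group) (auto simp: N_def)
    then show ?thesis
      by (simp add: g_def sum_distrib_right)
  qed
  have "f (e' q) - g (e' q) = 0"
    by (rule vandermonde_zero[OF finN cardN, of "\<lambda>z. f z - g z"])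
      (use q eq in \<open>auto simp: N_def[symmetric] left_diff_distrib sum_subtractf f g\<close>, auto simp: N_def)
  moreover have "{q'\<in>J. e' q' = e' q} = {q}"
    using inj q by (auto simp: inj_on_def)
  ultimately have fq: "f (e' q) = w' q"
    by (simp add: g_def)
  then obtain p where p: "p \<in> I" "e p = e' q"
    unfolding f_def using q(2) by (metis (mono_tags, lifting) mem_Collect_eq sum.not_neutral_contains_not_neutral)
  moreover have "{p'\<in>I. e p' = e' q} = {p}"
    using inj p by (auto simp: inj_on_def)
  ultimately show ?thesis
    using fq that by (simp add: f_def)
qed

text \<open>Compare a group, which is no union of two proper subgroups: if \<open>f a\<close> and
  \<open>f b\<close> differ, then \<open>g a = g b\<close>, and an element with another
  \<open>g\<close> value would have to share its \<open>f\<close> value with both \<open>a\<close>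
  and \<open>b\<close>.\<close>

lemma covering_equivalences:
  assumes cover: "\<And>j k. j \<in> X \<Longrightarrow> k \<in> X \<Longrightarrow> f j = f k \<or> g j = g k"
  shows "f constant_on X \<or> g constant_on X"
proof (rule ccontr)
  assume "\<not> ?thesis"
  then obtain a b c d where "a \<in> X" "b \<in> X" "c \<in> X" "d \<in> X" "f a \<noteq> f b" "g c \<noteq> g d"
    unfolding constant_on_def by metis
  then show False
    using cover by metis
qed

section \<open>Collision-free families\<close>

lemma collision_free_nonreal:
  assumes "absolutely_collision_free lam" "j \<noteq> k"
  shows "lam j * cnj (lam k) \<notin> \<real>"
proof
  assume "lam j * cnj (lam k) \<in> \<real>"
  then have "lam j * cnj (lam k) = lam k * cnj (lam j)"
    by (simp add: Reals_cnj_iff mult.commute)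
  then show False
    using assms unfolding absolutely_collision_free_def by (metis prod.inject)
qed

text \<open>Equal moduli would make the diagonal pairs \<open>(j, j)\<close> and
  \<open>(k, k)\<close> collide.\<close>

lemma collision_free_inj_cmod:
  assumes "absolutely_collision_free lam" "cmod (lam j) = cmod (lam k)"
  shows "j = k"
proof (rule ccontr)
  assume "j \<noteq> k"
  moreover have "lam j * cnj (lam j) = lam k * cnj (lam k)"
    using assms(2) by (simp flip: complex_norm_square)
  ultimately show False
    using assms(1) unfolding absolutely_collision_free_def by (metis prod.inject)
qed

section \<open>Phaseless samples on one support\<close>

lemma phaseless_samples_match:
  assumes fin: "finite I"
    and cf: "absolutely_collision_free lam" "absolutely_collision_free lam'"
    and nz: "\<And>k. k \<in> I \<Longrightarrow> c' k \<noteq> 0"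
    and eq: "\<And>l. l < 2 * (card I)\<^sup>2 \<Longrightarrow>
      cmod (\<Sum>k\<in>I. c' k * lam' k ^ l) = cmod (\<Sum>k\<in>I. c k * lam k ^ l)"
    and jk: "j \<in> I" "k \<in> I"
  obtains a b where "a \<in> I" "b \<in> I" "lam a * cnj (lam b) = lam' j * cnj (lam' k)"
    "c a * cnj (c b) = c' j * cnj (c' k)"
proof -
  \<comment> \<open>The same \<open>e\<close> builds the nodes from \<open>lam\<close> and the
    weights from \<open>c\<close>.\<close>
  define e where "e mu p = mu (fst p) * cnj (mu (snd p))" for mu :: "'a \<Rightarrow> complex" and p
  have inj: "inj_on (e mu) (I \<times> I)" if "absolutely_collision_free mu" for mu
    using that unfolding absolutely_collision_free_def e_def inj_on_def by (metis prod.collapse)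
  have sq: "complex_of_real ((cmod (\<Sum>k\<in>I. d k * mu k ^ l))\<^sup>2) = (\<Sum>p\<in>I \<times> I. e d p * e mu p ^ l)"
    for d mu :: "'a \<Rightarrow> complex" and l
    unfolding complex_norm_square e_def
    by (simp add: sum_product sum.cartesian_product case_prod_beta power_mult_distrib mult_ac)
  have card: "card (I \<times> I) + card (I \<times> I) = 2 * (card I)\<^sup>2"
    by (simp add: card_cartesian_product power2_eq_square)
  have "e c' (j, k) \<noteq> 0"
    using nz jk by (simp add: e_def)
  moreover have "(\<Sum>p\<in>I \<times> I. e c p * e lam p ^ l) = (\<Sum>p\<in>I \<times> I. e c' p * e lam' p ^ l)"
    if "l < card (I \<times> I) + card (I \<times> I)" for l
    using eq[of l] that unfolding card by (metis sq)
  ultimately obtain p where "p \<in> I \<times> I" "e lam p = e lam' (j, k)" "e c p = e c' (j, k)"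
    using exponential_sum_match[of "I \<times> I" "I \<times> I" "e lam" "e lam'" "e c" "e c'" "(j, k)"]
      fin jk inj cf by blast
  then show ?thesis
    using that[of "fst p" "snd p"] by (auto simp: e_def)
qed

text \<open>A diagonal node is real, and off-diagonal nodes are not, so the matching pair is
  diagonal as well.\<close>

lemma phaseless_samples_match_diag:
  assumes fin: "finite I"
    and cf: "absolutely_collision_free lam" "absolutely_collision_free lam'"
    and nz: "\<And>k. k \<in> I \<Longrightarrow> c' k \<noteq> 0"
    and eq: "\<And>l. l < 2 * (card I)\<^sup>2 \<Longrightarrow>
      cmod (\<Sum>k\<in>I. c' k * lam' k ^ l) = cmod (\<Sum>k\<in>I. c k * lam k ^ l)"
    and j: "j \<in> I"
  obtains a where "a \<in> I" "cmod (lam a) = cmod (lam' j)" "cmod (c a) = cmod (c' j)"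
proof -
  obtain a b where ab: "a \<in> I" "b \<in> I" "lam a * cnj (lam b) = lam' j * cnj (lam' j)"
    "c a * cnj (c b) = c' j * cnj (c' j)"
    using phaseless_samples_match[where c = c and c' = c' and j = j and k = j, OF fin cf nz eq j j] by metis
  have "lam a * cnj (lam b) \<in> \<real>"
    unfolding ab(3) by (simp flip: complex_norm_square)
  then have "a = b"
    using collision_free_nonreal[OF cf(1)] by blast
  then have "cmod (lam a) ^ 2 = cmod (lam' j) ^ 2" "cmod (c a) ^ 2 = cmod (c' j) ^ 2"
    using ab(3,4) by (simp_all flip: complex_norm_square of_real_power)
  then show ?thesis
    using that ab(1) by simp
qed

text \<open>This turns a condition on pairs into equality of values of one function. Multiplying by
  \<open>f k * g k\<close> produces \<open>f k * cnj (f k)\<close>, which may be replaced by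
  \<open>g k * cnj (g k)\<close>.\<close>

lemma ratio_eq_iff:
  assumes "cmod (f j) = cmod (g j)" "cmod (f k) = cmod (g k)" "g j \<noteq> 0" "g k \<noteq> (0 :: complex)"
  shows "f j / g j = f k / g k \<longleftrightarrow> f j * cnj (f k) = g j * cnj (g k)"
proof -
  have *: "f k * cnj (f k) = g k * cnj (g k)"
    using assms(2) by (simp flip: complex_norm_square)
  have fk: "f k \<noteq> 0"
    using assms by auto
  have "f j * cnj (f k) = g j * cnj (g k) \<longleftrightarrow> f j * (f k * cnj (f k)) * g k = g j * cnj (g k) * f k * g k"
    using fk assms(4) by (auto simp: mult_ac)
  also have "\<dots> \<longleftrightarrow> (g k * cnj (g k)) * (f j * g k) = (g k * cnj (g k)) * (f k * g j)"
    unfolding * by (simp only: mult_ac)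
  also have "\<dots> \<longleftrightarrow> f j / g j = f k / g k"
    using assms(3,4) by (simp add: field_simps)
  finally show ?thesis by simp
qed

text \<open>The second half of collision-freeness leaves only \<open>(a, b) = (j, k)\<close> or
  \<open>(a, b) = (k, j)\<close>; both options are equality of ratios, hence equivalence relations in
  \<open>(j, k)\<close>, and one of them must be total.\<close>

lemma phaseless_samples_orientation:
  assumes fin: "finite I"
    and cf: "absolutely_collision_free lam" "absolutely_collision_free lam'"
    and nz: "\<And>k. k \<in> I \<Longrightarrow> c k \<noteq> 0" "\<And>k. k \<in> I \<Longrightarrow> c' k \<noteq> 0" "\<And>k. lam k \<noteq> 0"
    and eq: "\<And>l. l < 2 * (card I)\<^sup>2 \<Longrightarrow>
      cmod (\<Sum>k\<in>I. c' k * lam' k ^ l) = cmod (\<Sum>k\<in>I. c k * lam k ^ l)"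
    and norm: "\<And>k. k \<in> I \<Longrightarrow> cmod (lam' k) = cmod (lam k)"
  shows "(\<lambda>k. (lam' k / lam k, c' k / c k)) constant_on I \<or>
    (\<lambda>k. (lam' k / cnj (lam k), c' k / cnj (c k))) constant_on I"
proof (rule covering_equivalences)
  \<comment> \<open>The moduli of the nodes already agree, so the matched diagonal index can only be
    \<open>k\<close>.\<close>
  have normc: "cmod (c' k) = cmod (c k)" if k: "k \<in> I" for k
  proof -
    obtain a where a: "a \<in> I" "cmod (lam a) = cmod (lam' k)" "cmod (c a) = cmod (c' k)"
      using phaseless_samples_match_diag[where c = c and c' = c' and j = k, OF fin cf nz(2) eq k] by metis
    moreover from a k have "a = k"
      using collision_free_inj_cmod[OF cf(1)] norm by metis
    ultimately show ?thesis by simp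
  qed
  fix j k assume jk: "j \<in> I" "k \<in> I"
  \<comment> \<open>\<open>D\<close> encodes that \<open>(j, k)\<close> is matched with itself,
    \<open>R\<close> that it is matched with \<open>(k, j)\<close>.\<close>
  have D: "(lam' j / lam j, c' j / c j) = (lam' k / lam k, c' k / c k) \<longleftrightarrow>
      lam' j * cnj (lam' k) = lam j * cnj (lam k) \<and> c' j * cnj (c' k) = c j * cnj (c k)"
    using ratio_eq_iff[of lam' j lam k] ratio_eq_iff[of c' j c k] jk norm normc nz by simp
  have R: "(lam' j / cnj (lam j), c' j / cnj (c j)) = (lam' k / cnj (lam k), c' k / cnj (c k)) \<longleftrightarrow>
      lam' j * cnj (lam' k) = lam k * cnj (lam j) \<and> c' j * cnj (c' k) = c k * cnj (c j)"
    using ratio_eq_iff[of lam' j "\<lambda>k. cnj (lam k)" k] ratio_eq_iff[of c' j "\<lambda>k. cnj (c k)" k]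
      jk norm normc nz by (simp add: mult.commute)
  show "(lam' j / lam j, c' j / c j) = (lam' k / lam k, c' k / c k) \<or>
    (lam' j / cnj (lam j), c' j / cnj (c j)) = (lam' k / cnj (lam k), c' k / cnj (c k))"
  proof (cases "j = k")
    case False
    obtain a b where ab: "a \<in> I" "b \<in> I" "lam a * cnj (lam b) = lam' j * cnj (lam' k)"
      "c a * cnj (c b) = c' j * cnj (c' k)"
      using phaseless_samples_match[where c = c and c' = c' and j = j and k = k, OF fin cf nz(2) eq jk] by metis
    \<comment> \<open>Otherwise the matched node would be real.\<close>
    have "a \<noteq> b"
      using collision_free_nonreal[OF cf(2) False] unfolding ab(3)[symmetric]
      by (auto simp flip: complex_norm_square)
    moreover have "cmod (lam a) * cmod (lam b) = cmod (lam j) * cmod (lam k)"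
      using arg_cong[OF ab(3), of cmod] norm jk by (simp add: norm_mult)
    ultimately have "{a, b} = {j, k}"
      using cf(1) False unfolding absolutely_collision_free_def by metis
    then show ?thesis
      unfolding D R using ab(3,4) by (auto simp: doubleton_eq_iff)
  qed simp
qed

section \<open>Propagation across overlapping supports\<close>

lemma phase_propagation_doubleton:
  assumes "phase_propagation \<psi>" "n \<ge> 1"
  obtains a b where "a \<noteq> b" "a \<in> supp (\<psi> n) \<inter> (\<Union>i<n. supp (\<psi> i))" "b \<in> supp (\<psi> n) \<inter> (\<Union>i<n. supp (\<psi> i))"
proof -
  define X where "X = supp (\<psi> n) \<inter> (\<Union>i<n. supp (\<psi> i))"
  have "infinite X \<or> card X \<ge> 2"
    using assms by (simp add: phase_propagation_def X_def Let_def)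
  then obtain T where "T \<subseteq> X" "card T = 2"
    by (metis infinite_arbitrarily_large obtain_subset_with_card_n)
  then show ?thesis
    using that by (auto simp: card_2_iff X_def)
qed

lemma constant_on_Un:
  assumes "f constant_on X" "f constant_on Y" "X \<inter> Y \<noteq> {}"
  shows "f constant_on (X \<union> Y)"
  using assms unfolding constant_on_def by (metis UnE disjoint_iff)

lemma constant_on_propagate:
  assumes pp: "phase_propagation \<psi>"
    and cover: "(\<Union>i. supp (\<psi> i)) = UNIV"
    and const: "\<And>i. r constant_on supp (\<psi> i) \<or> s constant_on supp (\<psi> i)"
    and sep: "\<And>a b. a \<noteq> b \<Longrightarrow> r a = r b \<Longrightarrow> s a \<noteq> s b"
  shows "r constant_on UNIV \<or> s constant_on UNIV"
proof -
  have step: "r constant_on (\<Union>i<Suc n. supp (\<psi> i)) \<or> s constant_on (\<Union>i<Suc n. supp (\<psi> i))" for n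
  proof (induction n)
    case 0
    then show ?case using const[of 0] by (simp add: lessThan_Suc)
  next
    case (Suc n)
    let ?X = "\<Union>i<Suc n. supp (\<psi> i)" and ?Y = "supp (\<psi> (Suc n))"
    have union: "(\<Union>i<Suc (Suc n). supp (\<psi> i)) = ?X \<union> ?Y"
      by (simp only: lessThan_Suc UN_insert Un_commute)
    obtain a b where ab: "a \<noteq> b" "a \<in> ?Y \<inter> ?X" "b \<in> ?Y \<inter> ?X"
      using phase_propagation_doubleton[OF pp, of "Suc n"] by auto
    \<comment> \<open>In a mixed case \<open>a\<close> and \<open>b\<close> would share both their
      \<open>r\<close> and \<open>s\<close> values, against \<open>sep\<close>.\<close>
    have "(r constant_on ?X \<and> r constant_on ?Y) \<or> (s constant_on ?X \<and> s constant_on ?Y)"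
      using Suc.IH const[of "Suc n"] sep[OF ab(1)] ab(2,3) unfolding constant_on_def
      by (metis IntE)
    moreover have "?X \<inter> ?Y \<noteq> {}"
      using ab by blast
    ultimately show ?case
      unfolding union using constant_on_Un[of r ?X ?Y] constant_on_Un[of s ?X ?Y] by argo
  qed
  show ?thesis
  \<comment> \<open>The alternative in \<open>step\<close> may vary with \<open>n\<close>. Any two
    indices lie in a common finite union, so the question is reduced to pairs.\<close>
  proof (rule covering_equivalences)
    fix j k :: 'a
    obtain p q where "j \<in> supp (\<psi> p)" "k \<in> supp (\<psi> q)"
      using cover by (metis UNIV_I UN_iff)
    then have "j \<in> (\<Union>i<Suc (p + q). supp (\<psi> i))" "k \<in> (\<Union>i<Suc (p + q). supp (\<psi> i))"
      using UN_I[of p "{..<Suc (p + q)}" j "\<lambda>i. supp (\<psi> i)"]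
        UN_I[of q "{..<Suc (p + q)}" k "\<lambda>i. supp (\<psi> i)"] by simp_all
    then show "r j = r k \<or> s j = s k"
      using step[of "p + q"] unfolding constant_on_def by metis
  qed
qed

section \<open>Index separation and the moduli\<close>

text \<open>The image of \<open>k\<close> lies in the same supports as \<open>k\<close>, hence in
  the combination of supports that isolates \<open>k\<close>.\<close>

lemma index_separation_fixes:
  assumes "index_separation \<psi>" "\<And>i k. \<tau> k \<in> supp (\<psi> i) \<longleftrightarrow> k \<in> supp (\<psi> i)"
  shows "\<tau> k = k"
proof -
  obtain F G where FG: "{k} = (\<Inter>i\<in>F. supp (\<psi> i)) - (\<Union>i\<in>G. supp (\<psi> i))"
    using assms(1) unfolding index_separation_def by metis
  then have "k \<in> (\<Inter>i\<in>F. supp (\<psi> i)) - (\<Union>i\<in>G. supp (\<psi> i))"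
    by blast
  then have "\<tau> k \<in> (\<Inter>i\<in>F. supp (\<psi> i)) - (\<Union>i\<in>G. supp (\<psi> i))"
    using assms(2) by simp
  then show ?thesis
    unfolding FG[symmetric] by simp
qed

text \<open>Each support carries a permutation matching the moduli of the two families. As the
  moduli are distinct, these glue to one map preserving every support.\<close>

lemma moduli_determined:
  assumes isep: "index_separation \<psi>"
    and inj: "inj (\<lambda>k. cmod (lam k))" "inj (\<lambda>k. cmod (lam' k))"
    and match: "\<And>i j. j \<in> supp (\<psi> i) \<Longrightarrow> \<exists>a\<in>supp (\<psi> i). cmod (lam a) = cmod (lam' j)"
    and match': "\<And>i j. j \<in> supp (\<psi> i) \<Longrightarrow> \<exists>a\<in>supp (\<psi> i). cmod (lam' a) = cmod (lam j)"
  shows "cmod (lam' k) = cmod (lam k)"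
proof -
  have "\<exists>a. cmod (lam a) = cmod (lam' j)" for j
    using isep match unfolding index_separation_def by (metis UNIV_I UN_iff)
  then obtain \<tau> where \<tau>: "\<And>j. cmod (lam (\<tau> j)) = cmod (lam' j)"
    by metis
  \<comment> \<open>By injectivity of the moduli, the witness of \<open>match\<close> for
    \<open>j\<close> is \<open>\<tau> j\<close>, and that of \<open>match'\<close> for
    \<open>\<tau> j\<close> is \<open>j\<close>.\<close>
  have "\<tau> j \<in> supp (\<psi> i) \<longleftrightarrow> j \<in> supp (\<psi> i)" for i j
    using match[of j i] match'[of "\<tau> j" i] \<tau> inj unfolding inj_def by metis
  then have "\<tau> k = k"
    by (rule index_separation_fixes[OF isep])
  then show ?thesis
    using \<tau>[of k] by simp
qed

section \<open>Winding direction\<close>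

text \<open>\<open>p\<close> is a real multiple of \<open>q\<close>; a positive factor keeps the
  argument, a negative one shifts it by \<open>pi\<close> in either direction.\<close>

lemma Arg_rcong_pi:
  assumes "p \<noteq> 0" "q \<noteq> 0" "p * cnj q \<in> \<real>"
  shows "[Arg p = Arg q] (rmod pi)"
proof -
  obtain t where t: "p * cnj q = of_real t"
    using assms(3) by (auto elim: Reals_cases)
  define u where "u = t / (cmod q)\<^sup>2"
  have "p * (q * cnj q) = of_real t * q"
    using t by (simp add: mult_ac)
  also have "q * cnj q = of_real ((cmod q)\<^sup>2)"
    by (rule complex_norm_square[symmetric])
  finally have p: "p = of_real u * q"
    using assms(2) by (simp add: u_def field_simps)
  then have "u \<noteq> 0"
    using assms(1) by auto
  show ?thesis
  proof (cases "u > 0")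
    case True
    then show ?thesis using p by simp
  next
    case False
    then have "Arg p = Arg (- q)"
      using p \<open>u \<noteq> 0\<close> Arg_times_of_real[of "- u" "- q"] by simp
    then have "Arg q = Arg p + of_int (-1) * pi \<or> Arg q = Arg p + of_int 1 * pi"
      using Arg_minus[OF assms(2)] by (auto split: if_splits)
    then show ?thesis
      unfolding rcong_altdef by blast
  qed
qed

text \<open>The constancy forces \<open>p / cnj p\<close> to take the same value for all the products
  \<open>p = coord (\<psi> i) k\<^sub>1 * cnj (coord (\<psi> i) k\<^sub>2)\<close>, i.e. fixes their argument modulo \<open>pi\<close>.\<close>

lemma winding_direction_not_reversed:
  assumes wd: "winding_direction \<psi>"
    and nz: "\<And>k. y k \<noteq> 0" "\<And>k. y' k \<noteq> 0"
    and rev: "\<And>i. (\<lambda>k. (coord (\<psi> i) k * y' k) / cnj (coord (\<psi> i) k * y k)) constant_on supp (\<psi> i)"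
  shows False
proof -
  obtain i\<^sub>1 i\<^sub>2 k\<^sub>1 k\<^sub>2 where
    wd: "coord (\<psi> i\<^sub>1) k\<^sub>1 * cnj (coord (\<psi> i\<^sub>1) k\<^sub>2) \<noteq> 0" "coord (\<psi> i\<^sub>2) k\<^sub>1 * cnj (coord (\<psi> i\<^sub>2) k\<^sub>2) \<noteq> 0"
      "\<not> [Arg (coord (\<psi> i\<^sub>1) k\<^sub>1 * cnj (coord (\<psi> i\<^sub>1) k\<^sub>2)) =
        Arg (coord (\<psi> i\<^sub>2) k\<^sub>1 * cnj (coord (\<psi> i\<^sub>2) k\<^sub>2))] (rmod pi)"
    using wd unfolding winding_direction_def Let_def by blast
  \<comment> \<open>Solving the constancy at \<open>k\<^sub>1\<close> and \<open>k\<^sub>2\<close>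
    for \<open>p / cnj p\<close> leaves \<open>R\<close>, which is independent of
    \<open>i\<close>.\<close>
  define R where "R = (y' k\<^sub>2 * cnj (y k\<^sub>1)) / (y' k\<^sub>1 * cnj (y k\<^sub>2))"
  have ratio: "p / cnj p = R" if "p = coord (\<psi> i) k\<^sub>1 * cnj (coord (\<psi> i) k\<^sub>2)" "p \<noteq> 0" for i p
  proof -
    have nzi: "coord (\<psi> i) k\<^sub>1 \<noteq> 0" "coord (\<psi> i) k\<^sub>2 \<noteq> 0"
      using that by auto
    then have "(coord (\<psi> i) k\<^sub>1 * y' k\<^sub>1) / cnj (coord (\<psi> i) k\<^sub>1 * y k\<^sub>1) =
        (coord (\<psi> i) k\<^sub>2 * y' k\<^sub>2) / cnj (coord (\<psi> i) k\<^sub>2 * y k\<^sub>2)"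
      using rev[of i] unfolding constant_on_def supp_def by force
    then show ?thesis
      using nz nzi unfolding that(1) R_def by (simp add: field_simps)
  qed
  define p q where "p = coord (\<psi> i\<^sub>1) k\<^sub>1 * cnj (coord (\<psi> i\<^sub>1) k\<^sub>2)"
    and "q = coord (\<psi> i\<^sub>2) k\<^sub>1 * cnj (coord (\<psi> i\<^sub>2) k\<^sub>2)"
  have pq: "p \<noteq> 0" "q \<noteq> 0"
    using wd(1,2) by (simp_all add: p_def q_def)
  have "p / cnj p = q / cnj q"
    using ratio[OF p_def pq(1)] ratio[OF q_def pq(2)] by simp
  then have "p * cnj q = q * cnj p"
    using pq by (simp add: frac_eq_eq)
  then have "p * cnj q \<in> \<real>"
    by (simp add: Reals_cnj_iff mult.commute)
  then show False
    using Arg_rcong_pi[OF pq] wd(3) by (simp add: p_def q_def)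
qed

section \<open>Recovery in coordinates\<close>

lemma unimodular_ratio:
  assumes "(\<lambda>k. f k / g k) constant_on UNIV" "\<And>k. cmod (f k) = cmod (g k)" "\<And>k. g k \<noteq> (0 :: complex)"
  obtains t :: real where "\<And>k. f k = exp (\<i> * of_real t) * g k"
proof -
  obtain u where u: "\<And>k. f k / g k = u"
    using assms(1) by (auto simp: constant_on_def)
  have "cmod u = 1"
    unfolding u[of undefined, symmetric] using assms(2,3) by (simp add: norm_divide)
  then obtain t where "u = exp (\<i> * of_real t)"
    using complex_norm_eq_1_exp_eq by (metis exp_eq_polar mult.left_neutral of_real_1)
  then show ?thesis
    using that[of t] u assms(3) by (metis nonzero_divide_eq_eq)
qed

text \<open>The theorem freed of operators: \<open>y\<close> and \<open>y'\<close> stand for the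
  conjugated coordinates of \<open>cadjoint S x\<close> and \<open>cadjoint S x'\<close>.\<close>

lemma coordinates_determined:
  fixes \<psi> :: "nat \<Rightarrow> 'z ell2"
  assumes isep: "index_separation \<psi>" and pp: "phase_propagation \<psi>" and wd: "winding_direction \<psi>"
    and fin: "\<And>i. finite (supp (\<psi> i))"
    and cf: "absolutely_collision_free lam" "absolutely_collision_free lam'"
    and lam: "\<And>k. lam k \<noteq> 0" and nz: "\<And>k. y k \<noteq> 0" "\<And>k. y' k \<noteq> 0"
    and eq: "\<And>i l. l < 2 * (card (supp (\<psi> i)))\<^sup>2 \<Longrightarrow>
      cmod (\<Sum>k\<in>supp (\<psi> i). (coord (\<psi> i) k * y' k) * lam' k ^ l) =
      cmod (\<Sum>k\<in>supp (\<psi> i). (coord (\<psi> i) k * y k) * lam k ^ l)"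
  obtains \<theta> \<eta> :: real where "\<And>k. lam' k = exp (\<i> * of_real \<theta>) * lam k"
    "\<And>k. y' k = exp (\<i> * of_real \<eta>) * y k"
proof -
  define c where "c i k = coord (\<psi> i) k * y k" for i k
  define c' where "c' i k = coord (\<psi> i) k * y' k" for i k
  have cover: "(\<Union>i. supp (\<psi> i)) = UNIV"
    using isep by (simp add: index_separation_def)
  have cnz: "c i k \<noteq> 0" "c' i k \<noteq> 0" if "k \<in> supp (\<psi> i)" for i k
    using nz that by (simp_all add: c_def c'_def supp_def)
  have eqc: "cmod (\<Sum>k\<in>supp (\<psi> i). c' i k * lam' k ^ l) = cmod (\<Sum>k\<in>supp (\<psi> i). c i k * lam k ^ l)"
    if "l < 2 * (card (supp (\<psi> i)))\<^sup>2" for i l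
    using eq[OF that] by (simp add: c_def c'_def)
  have inj: "inj (\<lambda>k. cmod (lam k))" "inj (\<lambda>k. cmod (lam' k))"
    using collision_free_inj_cmod cf by (auto intro!: injI)
  have diag: "\<exists>a\<in>supp (\<psi> i). cmod (lam a) = cmod (lam' j) \<and> cmod (c i a) = cmod (c' i j)"
    if "j \<in> supp (\<psi> i)" for i j
    using phaseless_samples_match_diag[where c = "c i" and c' = "c' i", OF fin cf cnz(2) eqc that] by metis
  have diag': "\<exists>a\<in>supp (\<psi> i). cmod (lam' a) = cmod (lam j)" if "j \<in> supp (\<psi> i)" for i j
    using phaseless_samples_match_diag[where c = "c' i" and c' = "c i", OF fin cf(2,1) cnz(1) eqc[symmetric] that] by metis
  have norm: "cmod (lam' k) = cmod (lam k)" for k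
    using diag diag' by (intro moduli_determined[OF isep inj]) blast+
  have normy: "cmod (y' k) = cmod (y k)" for k
  proof -
    obtain i where i: "k \<in> supp (\<psi> i)"
      using cover by blast
    then obtain a where a: "cmod (lam a) = cmod (lam' k)" "cmod (c i a) = cmod (c' i k)"
      using diag by blast
    then have "a = k"
      using norm collision_free_inj_cmod[OF cf(1)] by metis
    then show ?thesis
      using a(2) i by (simp add: c_def c'_def norm_mult supp_def)
  qed
  \<comment> \<open>Constancy of \<open>r\<close> means a common rotation, constancy of
    \<open>s\<close> a reflection followed by a rotation.\<close>
  define r where "r k = lam' k / lam k" for k
  define s where "s k = lam' k / cnj (lam k)" for k
  have local: "(r constant_on supp (\<psi> i) \<and> (\<lambda>k. c' i k / c i k) constant_on supp (\<psi> i)) \<or>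
      (s constant_on supp (\<psi> i) \<and> (\<lambda>k. c' i k / cnj (c i k)) constant_on supp (\<psi> i))" for i
    using phaseless_samples_orientation[where c = "c i" and c' = "c' i", OF fin cf cnz lam eqc norm]
    unfolding constant_on_def r_def s_def by (simp add: prod_eq_iff) metis
  have sep: "s a \<noteq> s b" if "a \<noteq> b" "r a = r b" for a b
  proof
    assume "s a = s b"
    have lam': "lam' k \<noteq> 0" for k
      using norm[of k] lam[of k] by auto
    \<comment> \<open>This quotient is \<open>cnj (lam a) / lam a\<close>, so equality at
      \<open>a\<close> and \<open>b\<close> makes \<open>lam a * cnj (lam b)\<close> real.\<close>
    have "r a / s a = r b / s b"
      using that \<open>s a = s b\<close> by simp
    then have "lam a * cnj (lam b) = cnj (lam a * cnj (lam b))"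
      using lam lam' by (simp add: r_def s_def field_simps)
    then show False
      using collision_free_nonreal[OF cf(1) that(1)] by (simp add: Reals_cnj_iff)
  qed
  have two: "\<exists>a b. a \<noteq> b \<and> a \<in> supp (\<psi> i) \<and> b \<in> supp (\<psi> i)" for i
  proof (cases i)
    case 0
    \<comment> \<open>The first support has no predecessor, but at \<open>n = 1\<close> the earlier
      union is exactly this support.\<close>
    obtain a b where "a \<noteq> b" "a \<in> (\<Union>i<1. supp (\<psi> i))" "b \<in> (\<Union>i<1. supp (\<psi> i))"
      using phase_propagation_doubleton[OF pp order.refl] by (metis IntE)
    with 0 show ?thesis
      by (auto simp: lessThan_Suc)
  next
    case (Suc n)
    then show ?thesis
      using phase_propagation_doubleton[OF pp, of i] by (metis IntE One_nat_def Suc_le_mono le0)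
  qed
  \<comment> \<open>Once \<open>r\<close> or \<open>s\<close> is known to be constant, this selects
    the disjunct of \<open>local\<close> and with it the statement on the coefficients.\<close>
  have excl: "\<not> (r constant_on supp (\<psi> i) \<and> s constant_on supp (\<psi> i))" for i
    using two[of i] sep unfolding constant_on_def by metis
  have "r constant_on UNIV \<or> s constant_on UNIV"
    using local sep by (intro constant_on_propagate[OF pp cover]) blast+
  moreover have "\<not> s constant_on UNIV"
  proof
    assume "s constant_on UNIV"
    then have "s constant_on supp (\<psi> i)" for i
      by (rule constant_on_subset) simp
    then have "(\<lambda>k. c' i k / cnj (c i k)) constant_on supp (\<psi> i)" for i
      using local excl by blast
    then show False
      unfolding c_def c'_def
      by (rule winding_direction_not_reversed[where y = y and y' = y', OF wd nz])
  qed
  ultimately have r: "r constant_on UNIV"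
    by blast
  have "(\<lambda>k. y' k / y k) constant_on supp (\<psi> i)" for i
  proof -
    have "r constant_on supp (\<psi> i)"
      using r by (rule constant_on_subset) simp
    then have "(\<lambda>k. c' i k / c i k) constant_on supp (\<psi> i)"
      using local excl by blast
    moreover have "c' i k / c i k = y' k / y k" if "k \<in> supp (\<psi> i)" for k
      using that by (simp add: c_def c'_def supp_def)
    ultimately show ?thesis
      by (simp add: constant_on_def)
  qed
  \<comment> \<open>Only one alternative is left here, so an injective \<open>s\<close> serves as a dummy.\<close>
  then have "(\<lambda>k. y' k / y k) constant_on UNIV \<or> (\<lambda>k. k) constant_on (UNIV :: 'z set)"
    by (intro constant_on_propagate[OF pp cover]) blast+
  moreover have "\<not> (\<lambda>k. k) constant_on (UNIV :: 'z set)"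
    using two unfolding constant_on_def by (metis UNIV_I)
  ultimately have yr: "(\<lambda>k. y' k / y k) constant_on UNIV"
    by blast
  obtain \<theta> :: real where "\<And>k. lam' k = exp (\<i> * of_real \<theta>) * lam k"
    using unimodular_ratio[OF r[unfolded r_def] norm lam] by blast
  moreover obtain \<eta> :: real where "\<And>k. y' k = exp (\<i> * of_real \<eta>) * y k"
    using unimodular_ratio[OF yr normy nz(1)] by blast
  ultimately show ?thesis
    using that by blast
qed

section \<open>From operator samples to coordinates\<close>

lemma coord_multop_funpow:
  "bounded (range lam) \<Longrightarrow> coord ((multop lam ^^ l) v) k = lam k ^ l * coord v k"
  by (induction l) (simp_all add: coord_multop mult_ac)

lemma invertible_op_bij: "invertible_op f \<Longrightarrow> bij f"
  unfolding invertible_op_def using o_bij by metis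

lemma diagonalizes_funpow:
  assumes "diagonalizes S lam A"
  shows "(A ^^ l) v = S ((multop lam ^^ l) (inv S v))"
proof -
  have A: "A = S \<circ> multop lam \<circ> inv S" and "bij S"
    using assms invertible_op_bij by (auto simp: diagonalizes_def)
  then have "inv S (S u) = u" "S (inv S v) = v" for u v
    by (simp_all add: bij_is_inj bij_is_surj surj_f_inv_f)
  then show ?thesis
    by (induction l) (simp_all add: A)
qed

text \<open>The modulus permits swapping the arguments, which puts the powers of \<open>A\<close>
  into the linear slot. The adjoint then moves \<open>S\<close> onto \<open>x\<close>, and the
  series reduces to the finite support.\<close>

lemma cmod_sample:
  assumes dg: "diagonalizes S lam A" and fin: "finite (supp (inv S v))"
  shows "cmod (cinner x ((A ^^ l) v)) =
    cmod (\<Sum>k\<in>supp (inv S v). (coord (inv S v) k * cnj (coord (cadjoint S x) k)) * lam k ^ l)"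
proof -
  let ?u = "(multop lam ^^ l) (inv S v)"
  have bl: "bounded_clinear S" and bd: "bounded (range lam)"
    using dg by (auto simp: diagonalizes_def invertible_op_def)
  have "cmod (cinner x ((A ^^ l) v)) = cmod (cinner ((A ^^ l) v) x)"
    by (metis cinner_commute complex_mod_cnj)
  also have "cinner ((A ^^ l) v) x = cinner ?u (cadjoint S x)"
    unfolding diagonalizes_funpow[OF dg] by (rule cinner_cadjoint[OF bl])
  also have "\<dots> = (\<Sum>\<^sub>\<infinity>k\<in>supp (inv S v). (coord (inv S v) k * cnj (coord (cadjoint S x) k)) * lam k ^ l)"
    unfolding cinner_ell2.rep_eq by (rule infsum_cong_neutral) (auto simp: supp_def coord_multop_funpow[OF bd])
  finally show ?thesis
    using fin by simp
qed

lemma cinner_scaleC_right: "cinner u (c *\<^sub>C v) = cnj c * cinner u v"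
  by (subst (1 2) cinner_commute) (simp add: cinner_scaleC_left)

text \<open>As \<open>S\<close> is onto, testing against the vectors \<open>S u\<close> separates
  points, which makes the adjoint injective.\<close>

lemma cadjoint_scaleC_cancel:
  fixes S :: "'z ell2 \<Rightarrow> 'h::complex_inner"
  assumes S: "invertible_op S" and eq: "cadjoint S x' = c *\<^sub>C cadjoint S x"
  shows "x' = c *\<^sub>C x"
proof -
  have bl: "bounded_clinear S"
    using S by (simp add: invertible_op_def)
  have "cinner v x' = cinner v (c *\<^sub>C x)" for v
  proof -
    obtain u where "v = S u"
      using invertible_op_bij[OF S] by (metis bij_is_surj surjD)
    then show ?thesis
      by (simp add: cinner_cadjoint[OF bl] eq cinner_scaleC_right)
  qed
  then show ?thesis
    by (metis vector_eq_ldot inner_eq_Re_cinner)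
qed

theorem theorem8p1:
  fixes S :: "'z ell2 \<Rightarrow> 'h::chilbert_space"
    and A A' :: "'h \<Rightarrow> 'h"
    and lam lam' :: "'z \<Rightarrow> complex"
    and \<phi> :: "nat \<Rightarrow> 'h"
    and x x' :: 'h
    and L :: "nat \<Rightarrow> nat"
  assumes "infinite_cdim TYPE('h)"
    and "countable (UNIV :: 'z set)" and "infinite (UNIV :: 'z set)"
    and "allows_identification_and_retrieval S \<phi>"
    and "\<And>i. finite (supp (inv S (\<phi> i)))"
    and "\<And>i. L i = card (supp (inv S (\<phi> i)))"
    and "invertible_op A" and "diagonalizes S lam A" and "absolutely_collision_free lam"
    and "\<And>k. coord (cadjoint S x) k \<noteq> 0"
    and "invertible_op A'" and "diagonalizes S lam' A'" and "absolutely_collision_free lam'"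
    and "\<And>k. coord (cadjoint S x') k \<noteq> 0"
    and "\<And>i l. l < 2 * (L i)\<^sup>2 \<Longrightarrow>
           cmod (cinner x' ((A' ^^ l) (\<phi> i))) = cmod (cinner x ((A ^^ l) (\<phi> i)))"
  shows "\<exists>(\<theta>::real) (\<eta>::real).
           (\<forall>k. lam' k = exp (\<i> * of_real \<theta>) * lam k) \<and> x' = exp (\<i> * of_real \<eta>) *\<^sub>C x"
proof -
  define \<psi> where "\<psi> i = inv S (\<phi> i)" for i
  \<comment> \<open>The conjugates stem from the second slot of \<open>cinner\<close>.\<close>
  let ?y = "\<lambda>k. cnj (coord (cadjoint S x) k)" and ?y' = "\<lambda>k. cnj (coord (cadjoint S x') k)"
  have S: "invertible_op S" and lam: "\<And>k. lam k \<noteq> 0"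
    using \<open>diagonalizes S lam A\<close> by (auto simp: diagonalizes_def)
  have pr: "index_separation \<psi>" "phase_propagation \<psi>" "winding_direction \<psi>"
    using assms(4) by (simp_all add: allows_identification_and_retrieval_def \<psi>_def[abs_def] Let_def)
  have "cmod (\<Sum>k\<in>supp (\<psi> i). (coord (\<psi> i) k * ?y' k) * lam' k ^ l) =
      cmod (\<Sum>k\<in>supp (\<psi> i). (coord (\<psi> i) k * ?y k) * lam k ^ l)"
    if "l < 2 * (card (supp (\<psi> i)))\<^sup>2" for i l
    using assms(15)[of l i] that assms(5,6)
      cmod_sample[OF assms(8), of "\<phi> i" x l] cmod_sample[OF assms(12), of "\<phi> i" x' l]
    by (simp add: \<psi>_def)
  then obtain \<theta> \<eta> :: real where \<theta>: "\<And>k. lam' k = exp (\<i> * of_real \<theta>) * lam k"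
    and \<eta>: "\<And>k. ?y' k = exp (\<i> * of_real \<eta>) * ?y k"
    using coordinates_determined[OF pr, of lam lam' ?y ?y'] assms(5,9,10,13,14) lam
    unfolding \<psi>_def complex_cnj_zero_iff by blast
  \<comment> \<open>Undoing the conjugation reverses the sign of the phase.\<close>
  have "coord (cadjoint S x') k = exp (\<i> * of_real (- \<eta>)) * coord (cadjoint S x) k" for k
    using arg_cong[OF \<eta>[of k], of cnj] by (simp add: exp_cnj)
  then have "cadjoint S x' = exp (\<i> * of_real (- \<eta>)) *\<^sub>C cadjoint S x"
    by (simp add: coord_inject[symmetric] scaleC_ell2.rep_eq fun_eq_iff)
  then have "x' = exp (\<i> * of_real (- \<eta>)) *\<^sub>C x"
    by (rule cadjoint_scaleC_cancel[OF S])
  with \<theta> show ?thesis by blast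
qed

end
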